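(* Let $(X,\|\cdot\|)$ be a complex semi-normed space and let $k\in X$. Consider the symmetric generalized two-norm on $X$ defined by $\|x,y\|=\|x\|\,\|y\|$ for $x,y\in X$ (so $\mathbb{W}=X\times X$ and $\mathbb{W}^k=X$). If $g\colon[a,b]\to(X,\|\cdot\|)$ is a function of bounded variation on $[a,b]$, then $g$ is also of bounded generalized 2-variation (associated with $k$) in $(X,\|\cdot,\cdot\|)$.
   Context: Let $A,B$ be complex vector spaces and $\mathbb{W}\subset A\times B$ a non-empty set such that for all $x\in A$, $y\in B$ the sets $\mathbb{W}^{y}=\{u\in A:(u,y)\in\mathbb{W}\}$ and $\mathbb{W}_{x}=\{v\in B:(x,v)\in\mathbb{W}\}$ are vector subspaces of $A$ and $B$ respectively. A generalized two-norm on $\mathbb{W}$ is a map $\|\cdot,\cdot\|\colon\mathbb{W}\to[0,\infty)$ such that: (G1) $\|x,\alpha y\|=|\alpha|\|x,y\|=\|\alpha x,y\|$ for all $\alpha\in\mathbb{C}$, $(x,y)\in\mathbb{W}$; (G2) $\|x,y+z\|\le\|x,y\|+\|x,z\|$ whenever $(x,y),(x,z)\in\mathbb{W}$; (G3) $\|x+y,z\|\le\|x,z\|+\|y,z\|$ whenever $(x,z),(y,z)\in\mathbb{W}$. The pair $(\mathbb{W}\subset A\times B,\|\cdot,\cdot\|)$ is called a generalized two-normed space. $[a,b]\subset\mathbb{R}$ is a closed interval and $\mathcal{P}([a,b])$ is the set of its finite partitions $P=\{a=t_0<t_1<\dots<t_n=b\}$. For $k\in B$, $g\colon[a,b]\to\mathbb{W}^k$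 and $P\in\mathcal{P}([a,b])$ put $V_a^b[g,\mathbb{W}^k;P]=\sum_{i=1}^n\|g(t_i)-g(t_{i-1}),k\|$. The function $g$ is of bounded generalized 2-variation (associated with $k$) if the set $\{V_a^b[g,\mathbb{W}^k;P]:P\in\mathcal{P}([a,b])\}$ is bounded above. A function $g\colon[a,b]\to(X,\|\cdot\|)$ into a semi-normed space is of bounded variation on $[a,b]$ if $\sup_{P\in\mathcal{P}([a,b])}\sum_{i=1}^n\|g(t_i)-g(t_{i-1})\|<\infty$. *)

theory Defs
  imports "HOL-Library.Extended_Real"
begin

locale complex_seminormed_space = vector_space scale
  for scale :: "complex \<Rightarrow> 'a::ab_group_add \<Rightarrow> 'a" +
  fixes p :: "'a \<Rightarrow> real"
  assumes seminorm_nonneg: "0 \<le> p x"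
    and seminorm_scale: "p (scale c x) = cmod c * p x"
    and seminorm_triangle: "p (x + y) \<le> p x + p y"

text \<open>The spaces $A$ and $B$ are the types \<open>'a\<close> and \<open>'b\<close>. The two-norm \<open>N\<close> is a curried
  total function; it is constrained, and used, only on \<open>W\<close>.\<close>

definition section_left :: "('a \<times> 'b) set \<Rightarrow> 'b \<Rightarrow> 'a set" where
  "section_left W y = {u. (u, y) \<in> W}"

definition section_right :: "('a \<times> 'b) set \<Rightarrow> 'a \<Rightarrow> 'b set" where
  "section_right W x = {v. (x, v) \<in> W}"

locale generalized_two_normed_space = A: vector_space scaleA + B: vector_space scaleB
  for scaleA :: "complex \<Rightarrow> 'a::ab_group_add \<Rightarrow> 'a"
    and scaleB :: "complex \<Rightarrow> 'b::ab_group_add \<Rightarrow> 'b" +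
  fixes W :: "('a \<times> 'b) set" and N :: "'a \<Rightarrow> 'b \<Rightarrow> real"
  assumes nonempty: "W \<noteq> {}"
    and subspace_left: "A.subspace (section_left W y)"
    and subspace_right: "B.subspace (section_right W x)"
    and nonneg: "(x, y) \<in> W \<Longrightarrow> 0 \<le> N x y"
    and G1_right: "(x, y) \<in> W \<Longrightarrow> N x (scaleB c y) = cmod c * N x y"
    and G1_left: "(x, y) \<in> W \<Longrightarrow> N (scaleA c x) y = cmod c * N x y"
    and G2: "(x, y) \<in> W \<Longrightarrow> (x, z) \<in> W \<Longrightarrow> N x (y + z) \<le> N x y + N x z"
    and G3: "(x, y) \<in> W \<Longrightarrow> (u, y) \<in> W \<Longrightarrow> N (x + u) y \<le> N x y + N u y"

definition symmetric_two_norm :: "('a \<times> 'a) set \<Rightarrow> ('a \<Rightarrow> 'a \<Rightarrow> real) \<Rightarrow> bool" where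
  "symmetric_two_norm W N \<longleftrightarrow> W\<inverse> = W \<and> (\<forall>(x, y)\<in>W. N x y = N y x)"

text \<open>The partition $a = t_0 < t_1 < \dots < t_n = b$ is the list of its $n + 1$ points. For
  $a = b$ this gives the one-point partition, with $n = 0$.\<close>

definition partitions :: "real \<Rightarrow> real \<Rightarrow> real list set" where
  "partitions a b = {t. t \<noteq> [] \<and> sorted_wrt (<) t \<and> hd t = a \<and> last t = b}"

definition variation_sum :: "('a::ab_group_add \<Rightarrow> real) \<Rightarrow> (real \<Rightarrow> 'a) \<Rightarrow> real list \<Rightarrow> real" where
  "variation_sum p g t = (\<Sum>i = 1..length t - 1. p (g (t ! i) - g (t ! (i - 1))))"

definition bounded_variation ::
  "('a::ab_group_add \<Rightarrow> real) \<Rightarrow> real \<Rightarrow> real \<Rightarrow> (real \<Rightarrow> 'a) \<Rightarrow> bool" where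
  "bounded_variation p a b g \<longleftrightarrow> (SUP t\<in>partitions a b. ereal (variation_sum p g t)) < \<infinity>"

definition two_variation_sum ::
  "('a::ab_group_add \<Rightarrow> 'b \<Rightarrow> real) \<Rightarrow> 'b \<Rightarrow> (real \<Rightarrow> 'a) \<Rightarrow> real list \<Rightarrow> real" where
  "two_variation_sum N k g t = (\<Sum>i = 1..length t - 1. N (g (t ! i) - g (t ! (i - 1))) k)"

text \<open>A function on $[a,b]$ is a function on the reals of which only the values on \<open>{a..b}\<close>
  matter.\<close>

definition bounded_generalized_two_variation ::
  "('a::ab_group_add \<times> 'b) set \<Rightarrow> ('a \<Rightarrow> 'b \<Rightarrow> real) \<Rightarrow> 'b \<Rightarrow> real \<Rightarrow> real \<Rightarrow> (real \<Rightarrow> 'a) \<Rightarrow> bool" where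
  "bounded_generalized_two_variation W N k a b g \<longleftrightarrow>
     g ` {a..b} \<subseteq> section_left W k \<and>
     bdd_above {two_variation_sum N k g t | t. t \<in> partitions a b}"

end

theory Submission
  imports Defs
begin

text \<open>With k fixed, the product two-norm is the seminorm \<open>p\<close> times the constant
  \<open>p k\<close>. That constant comes out of every finite sum, so each 2-variation sum equals
  the ordinary variation sum times \<open>p k\<close> (\<open>two_variation_sum_product\<close>). A
  bound \<open>M\<close> for the latter sums therefore gives the bound \<open>M * p k\<close> for
  the former. The axioms of a generalized two-norm hold for the same reason: with one argument
  fixed, the product is a non-negative multiple of a seminorm.\<close>

lemma bounded_variation_imp_le:
  assumes "bounded_variation p a b g"
  obtains M where "\<And>t. t \<in> partitions a b \<Longrightarrow> variation_sum p g t \<le> M"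
proof -
  \<comment> \<open>A natural number above the supremum serves as bound even if the supremum is
    minus infinity, which happens for b < a, when there are no partitions.\<close>
  obtain n :: nat where n: "(SUP t\<in>partitions a b. ereal (variation_sum p g t)) < ereal (real n)"
    using assms less_PInf_Ex_of_nat unfolding bounded_variation_def by (metis less_irrefl)
  have "variation_sum p g t \<le> real n" if "t \<in> partitions a b" for t
    using order.strict_trans1[OF SUP_upper[OF that] n] by simp
  then show ?thesis by (rule that)
qed

lemma two_variation_sum_product:
  "two_variation_sum (\<lambda>x y. p x * q y) k g t = variation_sum p g t * q k"
  by (simp add: two_variation_sum_def variation_sum_def sum_distrib_right)

text \<open>Phrased with \<open>UNIV\<close> because simplification rewrites
  \<open>UNIV \<times> UNIV\<close> to it.\<close>

lemma section_left_UNIV [simp]: "section_left UNIV k = UNIV"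
  by (simp add: section_left_def)

lemma section_right_UNIV [simp]: "section_right UNIV x = UNIV"
  by (simp add: section_right_def)

lemma symmetric_two_norm_product: "symmetric_two_norm (UNIV \<times> UNIV) (\<lambda>x y. p x * p y)"
  by (auto simp: symmetric_two_norm_def mult.commute)

lemma (in complex_seminormed_space) generalized_two_normed_space_product:
  "generalized_two_normed_space scale scale (UNIV \<times> UNIV) (\<lambda>x y. p x * p y)"
proof unfold_locales
  \<comment> \<open>G3, and below it G2, is the triangle inequality multiplied by the non-negative
    value at the fixed argument.\<close>
  show "p (x + u) * p y \<le> p x * p y + p u * p y" for x y u
    using mult_right_mono[OF seminorm_triangle seminorm_nonneg] by (simp add: distrib_right)
  show "p x * p (y + z) \<le> p x * p y + p x * p z" for x y z
    using mult_left_mono[OF seminorm_triangle seminorm_nonneg] by (simp add: distrib_left)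
qed (simp_all add: seminorm_nonneg seminorm_scale subspace_UNIV)

lemma bounded_generalized_two_variation_product:
  assumes "bounded_variation p a b g" and "0 \<le> q k"
  shows "bounded_generalized_two_variation (UNIV \<times> UNIV) (\<lambda>x y. p x * q y) k a b g"
proof -
  obtain M where "\<And>t. t \<in> partitions a b \<Longrightarrow> variation_sum p g t \<le> M"
    using assms(1) by (rule bounded_variation_imp_le) blast
  \<comment> \<open>Multiplying by \<open>q k\<close> keeps the direction of the inequality since
    \<open>0 \<le> q k\<close>.\<close>
  then have "bdd_above {variation_sum p g t * q k | t. t \<in> partitions a b}"
    using assms(2) by (intro bdd_aboveI[where M = "M * q k"]) (auto intro: mult_right_mono)
  then show ?thesis
    by (simp add: bounded_generalized_two_variation_def two_variation_sum_product)
qed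

theorem proposition4p8:
  fixes scale :: "complex \<Rightarrow> 'a::ab_group_add \<Rightarrow> 'a"
    and p :: "'a \<Rightarrow> real" and k :: 'a
    and a b :: real and g :: "real \<Rightarrow> 'a"
  assumes "complex_seminormed_space scale p"
    and "a \<le> b"
    and "bounded_variation p a b g"
  shows "generalized_two_normed_space scale scale (UNIV \<times> UNIV) (\<lambda>x y. p x * p y)
    \<and> symmetric_two_norm (UNIV \<times> UNIV) (\<lambda>x y. p x * p y)
    \<and> section_left (UNIV \<times> UNIV) k = (UNIV :: 'a set)
    \<and> bounded_generalized_two_variation (UNIV \<times> UNIV) (\<lambda>x y. p x * p y) k a b g"
proof -
  interpret complex_seminormed_space scale p by fact
  show ?thesis
    using generalized_two_normed_space_product symmetric_two_norm_product
      bounded_generalized_two_variation_product[of p a b g p k, OF assms(3) seminorm_nonneg]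
    by simp
qed

end
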